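(* Let $f_1(\Theta)=\frac{2\Theta^2+2\Theta}{\Theta^2+\Theta-2}$ and $f_2(\Theta)=\Theta+1-\frac{\Theta-1}{3\Theta+3}$, and let $\Theta^*$ be the only positive, real solution of $f_1(\Theta)=f_2(\Theta)$, i.e., $$\Theta^*+1-\frac{\Theta^*-1}{3\Theta^*+3}=\frac{2\Theta^{*2}+2\Theta^*}{\Theta^{*2}+\Theta^*-2}.$$ Then, for open, non-preemptive online Dial-a-Ride on the line, $\textsc{Smartstart}_{\Theta^*}$ is $\rho^*$-competitive with $\rho^*:=f_1(\Theta^* )=f_2(\Theta^* )\approx 2.93768$.
   Context: Open, non-preemptive Dial-a-Ride on the real line. An instance is a finite nonempty set of requests $\sigma=\{\sigma_1,\dots,\sigma_n\}$ with $\sigma_i=(a_i,b_i;r_i)$, $a_i,b_i\in\mathbb{R}$, $r_i\ge 0$: request $\sigma_i$ appears at time $r_i$ at position $a_i$ and must be transported to position $b_i$. A single server of capacity $c\in\mathbb{N}\cup\{\infty\}$ (arbitrary but fixed) starts at the origin at time $0$, moves with unit speed (it may also wait), cannot pick up a request before its release time, never carries more than $c$ requests at once, and a request that was picked up stays on board until it is delivered at its destination (non-preemptive). In the open version the server need not return to the origin. The length of a schedule is the time from its start until its last request is delivered (waiting included). $L(t,p,R)$ is the length of a shortest schedule that starts at position $p$ at time $t$ and serves all requests in $R\subseteq\sigma$ respecting release times. The offline optimum is $\textsc{Opt}(\sigma):=L(0,0,\sigma)$. In the online problem, $\sigma_i$ is revealed only at time $r_i$, and the number of requests is not known in advance. Algorithm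 $\textsc{Smartstart}_\Theta$ (parameter $\Theta>1$): let $R_t$ be the set of requests with release time at most $t$ that have not been served by time $t$. Starting at position $p_1=0$ at time $0$, for $j=1,2,\dots$: whenever the server is idle at position $p_j$ at current time $t$, it waits until there are unserved released requests and then until the earliest time $t_j:=\min\{t'\ge t: R_{t'}\ne\emptyset,\ t'\ge L(t',p_j,R_{t'})/(\Theta-1)\}$. At time $t_j$ it starts a shortest schedule $S_j$ serving $R_{t_j}$ from $p_j$, and executes it while ignoring all newly appearing requests; it ends at position $p_{j+1}$, the position where the last request of $S_j$ is delivered. $\textsc{Smartstart}(\sigma)$ denotes the time at which all requests of $\sigma$ have been served. An online algorithm is $\rho$-competitive if its completion time on every instance $\sigma$ is at most $\rho\,\textsc{Opt}(\sigma)$. *)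

theory Defs
  imports Complex_Main "HOL-Library.Extended_Nat"
begin

(* The requests sigma_1, ..., sigma_n are the entries of a nonempty list, and a request is referred
   to by its index; sets of requests are sets of indices.  Two entries may carry equal data. *)
datatype request = Request (src: real) (dst: real) (rel_time: real)

definition dial_a_ride_instance :: "request list \<Rightarrow> bool" where
  "dial_a_ride_instance \<sigma> \<longleftrightarrow> \<sigma> \<noteq> [] \<and> (\<forall>r \<in> set \<sigma>. rel_time r \<ge> 0)"

(* A schedule is the sequence of its pick-ups and deliveries, each with the time at which it takes
   place.  Several actions may take place at the same time; their order in the list is then the
   order in which they are performed. *)
datatype action = Pickup nat | Deliver nat

type_synonym schedule = "(real \<times> action) list"

fun location :: "request list \<Rightarrow> action \<Rightarrow> real" where
  "location \<sigma> (Pickup i) = src (\<sigma> ! i)"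
| "location \<sigma> (Deliver i) = dst (\<sigma> ! i)"

fun earliest :: "request list \<Rightarrow> action \<Rightarrow> real \<Rightarrow> bool" where
  "earliest \<sigma> (Pickup i) s \<longleftrightarrow> rel_time (\<sigma> ! i) \<le> s"
| "earliest \<sigma> (Deliver i) s \<longleftrightarrow> True"

(* A server of unit speed that may wait gets from position p at time t to position q at time s
   if and only if |q - p| <= s - t. *)
fun executable :: "request list \<Rightarrow> real \<Rightarrow> real \<Rightarrow> schedule \<Rightarrow> bool" where
  "executable \<sigma> t p [] \<longleftrightarrow> True"
| "executable \<sigma> t p ((s, x) # S) \<longleftrightarrow>
     \<bar>location \<sigma> x - p\<bar> \<le> s - t \<and> earliest \<sigma> x s \<and> executable \<sigma> s (location \<sigma> x) S"

definition actions :: "schedule \<Rightarrow> action set" where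
  "actions S = snd ` set S"

definition on_board :: "schedule \<Rightarrow> nat set" where
  "on_board S = {i. Pickup i \<in> actions S \<and> Deliver i \<notin> actions S}"

(* Non-preemption: every request in R is picked up once, at its source, and put down once, at its
   destination. *)
definition is_schedule ::
  "enat \<Rightarrow> request list \<Rightarrow> real \<Rightarrow> real \<Rightarrow> nat set \<Rightarrow> schedule \<Rightarrow> bool" where
  "is_schedule c \<sigma> t p R S \<longleftrightarrow>
     executable \<sigma> t p S \<and>
     distinct (map snd S) \<and>
     actions S = Pickup ` R \<union> Deliver ` R \<and>
     (\<forall>k < length S. \<forall>i. snd (S ! k) = Deliver i \<longrightarrow> Pickup i \<in> actions (take k S)) \<and>
     (\<forall>k \<le> length S. enat (card (on_board (take k S))) \<le> c)"

(* The last action of a nonempty schedule is a delivery. *)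
definition schedule_length :: "real \<Rightarrow> schedule \<Rightarrow> real" where
  "schedule_length t S = (if S = [] then 0 else fst (last S) - t)"

definition end_position :: "request list \<Rightarrow> real \<Rightarrow> schedule \<Rightarrow> real" where
  "end_position \<sigma> p S = (if S = [] then p else location \<sigma> (snd (last S)))"

definition shortest_schedule ::
  "enat \<Rightarrow> request list \<Rightarrow> real \<Rightarrow> real \<Rightarrow> nat set \<Rightarrow> schedule \<Rightarrow> bool" where
  "shortest_schedule c \<sigma> t p R S \<longleftrightarrow>
     is_schedule c \<sigma> t p R S \<and>
     (\<forall>S'. is_schedule c \<sigma> t p R S' \<longrightarrow> schedule_length t S \<le> schedule_length t S')"

definition L :: "enat \<Rightarrow> request list \<Rightarrow> real \<Rightarrow> real \<Rightarrow> nat set \<Rightarrow> real" where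
  "L c \<sigma> t p R = (LEAST l. \<exists>S. is_schedule c \<sigma> t p R S \<and> l = schedule_length t S)"

definition Opt :: "enat \<Rightarrow> request list \<Rightarrow> real" where
  "Opt c \<sigma> = L c \<sigma> 0 0 {..<length \<sigma>}"

definition released :: "request list \<Rightarrow> nat set \<Rightarrow> real \<Rightarrow> nat set" where
  "released \<sigma> U s = {i \<in> U. rel_time (\<sigma> ! i) \<le> s}"

(* With U the set of requests not yet served, R_s = released \<sigma> U s while the server is idle. *)
definition may_start ::
  "enat \<Rightarrow> real \<Rightarrow> request list \<Rightarrow> real \<Rightarrow> nat set \<Rightarrow> real \<Rightarrow> bool" where
  "may_start c \<Theta> \<sigma> p U s \<longleftrightarrow>
     released \<sigma> U s \<noteq> {} \<and> s \<ge> L c \<sigma> s p (released \<sigma> U s) / (\<Theta> - 1)"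

(* smartstart_from c \<Theta> \<sigma> t p U T: if the server is idle at position p at time t and U is the set of
   requests not yet served, then some run of the algorithm completes all requests at time T.
   Shortest schedules need not be unique; a run may use any of them in each round. *)
inductive smartstart_from ::
  "enat \<Rightarrow> real \<Rightarrow> request list \<Rightarrow> real \<Rightarrow> real \<Rightarrow> nat set \<Rightarrow> real \<Rightarrow> bool"
  for c \<Theta> \<sigma> where
  finished: "smartstart_from c \<Theta> \<sigma> t p {} t"
| round: "\<lbrakk> s \<ge> t; may_start c \<Theta> \<sigma> p U s;
           \<And>s'. \<lbrakk> s' \<ge> t; may_start c \<Theta> \<sigma> p U s' \<rbrakk> \<Longrightarrow> s \<le> s';
           shortest_schedule c \<sigma> s p (released \<sigma> U s) S;
           smartstart_from c \<Theta> \<sigma> (s + schedule_length s S) (end_position \<sigma> p S)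
             (U - released \<sigma> U s) T \<rbrakk>
         \<Longrightarrow> smartstart_from c \<Theta> \<sigma> t p U T"

definition smartstart :: "enat \<Rightarrow> real \<Rightarrow> request list \<Rightarrow> real \<Rightarrow> bool" where
  "smartstart c \<Theta> \<sigma> T \<longleftrightarrow> smartstart_from c \<Theta> \<sigma> 0 0 {..<length \<sigma>} T"

(* A \<sigma> T: T is a completion time of the algorithm A on \<sigma>.  The bound has to hold for every way of
   breaking ties inside A. *)
definition competitive :: "enat \<Rightarrow> real \<Rightarrow> (request list \<Rightarrow> real \<Rightarrow> bool) \<Rightarrow> bool" where
  "competitive c \<rho> A \<longleftrightarrow>
     (\<forall>\<sigma>. dial_a_ride_instance \<sigma> \<longrightarrow> (\<exists>T. A \<sigma> T) \<and> (\<forall>T. A \<sigma> T \<longrightarrow> T \<le> \<rho> * Opt c \<sigma>))"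

(* At the pole \<Theta> = 1, division by zero gives f1 1 = 0, which differs from f2 1 = 2, so totality of
   division adds no positive solution of f1 \<Theta> = f2 \<Theta>. *)
definition f1 :: "real \<Rightarrow> real" where
  "f1 \<Theta> = (2 * \<Theta>\<^sup>2 + 2 * \<Theta>) / (\<Theta>\<^sup>2 + \<Theta> - 2)"

definition f2 :: "real \<Rightarrow> real" where
  "f2 \<Theta> = \<Theta> + 1 - (\<Theta> - 1) / (3 * \<Theta> + 3)"

definition Theta_star :: real where
  "Theta_star = (THE \<Theta>. \<Theta> > 0 \<and> f1 \<Theta> = f2 \<Theta>)"

definition rho_star :: real where
  "rho_star = f1 Theta_star"

end

(* Once all requests of R are released, following the restriction to R of an optimal schedule from
   its first pickup (time tau, position a) to its last delivery (time C) shows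
   L(t,p,R) <= |p - a| + C - tau.  Moreover a round that starts at time t1 ends by time Theta * t1,
   so its end position p satisfies |p| <= Theta * t1, and the requests of the next round are
   released, hence picked up by the optimum, only after t1.

   If the server waits before a round, it starts at a release time or at length / (Theta - 1).
   Comparing the moments at which the optimum visits p and a bounds the length of the round by
   (2 Theta + 2) / (Theta + 2) * Opt, which gives f1.

   If it does not wait, let eta be the time by which the optimum reaches a later than |p - a|.
   Then the completion time is at most Theta tau + Opt - eta.  If the optimum is done with the
   previous round's requests before it reaches a, it is also at most 2 Opt + (3 Theta + 2) eta:
   the previous round ends at p although the optimum's last delivery lies towards a, and a shortest
   schedule makes that detour only if it is short.  The two bounds balance at f2.  If the optimum
   still serves requests of the previous round after reaching a, the same detour argument shows
   that eta and Opt - tau cannot both be small, and the first bound suffices. *)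
theory Submission
  imports Defs
begin

section \<open>Schedules\<close>

lemma executable_event:
  assumes "executable \<sigma> t p S" "(s, x) \<in> set S"
  shows "\<bar>location \<sigma> x - p\<bar> \<le> s - t \<and> earliest \<sigma> x s"
  using assms
proof (induction \<sigma> t p S rule: executable.induct)
  case (2 \<sigma> t p s' x' S)
  then show ?case by (cases "(s, x) = (s', x')") fastforce+
qed simp

lemma executable_Lipschitz:
  assumes "executable \<sigma> t p S" "(s, x) \<in> set S" "(s', y) \<in> set S"
  shows "\<bar>location \<sigma> x - location \<sigma> y\<bar> \<le> \<bar>s - s'\<bar>"
  using assms
proof (induction \<sigma> t p S rule: executable.induct)
  case (2 \<sigma> t p s0 x0 S)
  have *: "\<bar>location \<sigma> v - location \<sigma> x0\<bar> \<le> u - s0" if "(u, v) \<in> set S" for u v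
    using executable_event[of \<sigma> s0 "location \<sigma> x0" S u v] 2(2) that by simp
  have "(s, x) = (s0, x0) \<or> (s, x) \<in> set S" "(s', y) = (s0, x0) \<or> (s', y) \<in> set S"
    using 2(3,4) by auto
  then show ?case
    using 2(1,2) *[of s x] *[of s' y] by (elim disjE) auto
qed simp

lemma executable_le_last:
  assumes "executable \<sigma> t p S" "(s, x) \<in> set S"
  shows "s \<le> fst (last S)"
  using assms
proof (induction \<sigma> t p S rule: executable.induct)
  case (2 \<sigma> t p s0 x0 S)
  show ?case
  proof (cases "S = []")
    case False
    have "0 \<le> fst (last S) - s0"
      using executable_event[of \<sigma> s0 "location \<sigma> x0" S "fst (last S)" "snd (last S)"] 2(2) False
      by (auto intro: order_trans[OF abs_ge_zero])
    then have "s0 \<le> fst (last S)" by simp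
    then show ?thesis using 2 False by auto
  qed (use 2 in auto)
qed simp

text \<open>A server at \<open>p'\<close> at time \<open>t'\<close> has enough time to be at
  \<open>p\<close> at time \<open>t\<close>, so the triangle inequality applies to the first action.
  This is what allows \<open>executable_filter\<close> to skip actions.\<close>

lemma executable_weaken:
  assumes "executable \<sigma> t p S" "\<bar>p - p'\<bar> \<le> t - t'"
  shows "executable \<sigma> t' p' S"
  using assms by (cases "(\<sigma>, t, p, S)" rule: executable.cases) auto

lemma executable_filter: "executable \<sigma> t p S \<Longrightarrow> executable \<sigma> t p (filter P S)"
proof (induction \<sigma> t p S rule: executable.induct)
  case (2 \<sigma> t p s x S)
  then show ?case
    using executable_weaken[of \<sigma> s "location \<sigma> x" "filter P S" p t] by auto
qed simp

definition delay :: "real \<Rightarrow> schedule \<Rightarrow> schedule" where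
  "delay d S = map (\<lambda>(s, x). (s + d, x)) S"

lemma map_snd_delay [simp]: "map snd (delay d S) = map snd S"
  by (auto simp: delay_def)

lemma delay_eq_Nil [simp]: "delay d S = [] \<longleftrightarrow> S = []"
  by (simp add: delay_def)

lemma last_delay: "S \<noteq> [] \<Longrightarrow> last (delay d S) = (fst (last S) + d, snd (last S))"
  by (simp add: delay_def last_map case_prod_beta)

lemma executable_delay:
  assumes "executable \<sigma> s q S" "\<And>s x. (s, x) \<in> set S \<Longrightarrow> earliest \<sigma> x (s + d)"
  shows "executable \<sigma> (s + d) q (delay d S)"
  using assms
  by (induction \<sigma> s q S rule: executable.induct) (auto simp: delay_def)

section \<open>Orders of actions, stripped of their times\<close>

definition carried :: "action list \<Rightarrow> nat set" where
  "carried xs = {i. Pickup i \<in> set xs \<and> Deliver i \<notin> set xs}"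

text \<open>The time-free half of \<open>is_schedule\<close>. Splits \<open>us @ vs\<close> replace
  indices because they behave well under filtering.\<close>

definition feasible_order :: "enat \<Rightarrow> nat set \<Rightarrow> action list \<Rightarrow> bool" where
  "feasible_order c R xs \<longleftrightarrow>
     distinct xs \<and> set xs = Pickup ` R \<union> Deliver ` R \<and>
     (\<forall>us i vs. xs = us @ Deliver i # vs \<longrightarrow> Pickup i \<in> set us) \<and>
     (\<forall>us vs. xs = us @ vs \<longrightarrow> enat (card (carried us)) \<le> c)"

lemma is_schedule_iff:
  "is_schedule c \<sigma> t p R S \<longleftrightarrow> executable \<sigma> t p S \<and> feasible_order c R (map snd S)"
proof -
  have A: "actions (take k S) = set (take k (map snd S))" for k
    by (simp add: actions_def take_map)
  have B: "on_board (take k S) = carried (take k (map snd S))" for k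
    by (simp add: on_board_def carried_def A)
  have C: "(\<forall>k < length S. \<forall>i. snd (S ! k) = Deliver i \<longrightarrow> Pickup i \<in> actions (take k S)) \<longleftrightarrow>
        (\<forall>us i vs. map snd S = us @ Deliver i # vs \<longrightarrow> Pickup i \<in> set us)" (is "?l \<longleftrightarrow> ?r")
  proof
    assume l: ?l
    show ?r
    proof (intro allI impI)
      fix us i vs assume *: "map snd S = us @ Deliver i # vs"
      have "length us < length S" using arg_cong[OF *, of length] by simp
      moreover from this have "snd (S ! length us) = Deliver i"
        using arg_cong[OF *, of "\<lambda>xs. xs ! length us"] by simp
      ultimately have "Pickup i \<in> actions (take (length us) S)" using l by blast
      then show "Pickup i \<in> set us" by (simp add: A *)
    qed
  next
    assume r: ?r
    show ?l
    proof (intro allI impI)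
      fix k i assume *: "k < length S" "snd (S ! k) = Deliver i"
      have "map snd S = take k (map snd S) @ Deliver i # drop (Suc k) (map snd S)"
        using id_take_nth_drop[of k "map snd S"] * by simp
      with r have "Pickup i \<in> set (take k (map snd S))" by blast
      then show "Pickup i \<in> actions (take k S)" by (simp add: A)
    qed
  qed
  have D: "(\<forall>k \<le> length S. enat (card (on_board (take k S))) \<le> c) \<longleftrightarrow>
        (\<forall>us vs. map snd S = us @ vs \<longrightarrow> enat (card (carried us)) \<le> c)" (is "?l \<longleftrightarrow> ?r")
  proof
    assume l: ?l
    show ?r
    proof (intro allI impI)
      fix us vs assume *: "map snd S = us @ vs"
      have "length us \<le> length S" using arg_cong[OF *, of length] by simp
      with l have "enat (card (on_board (take (length us) S))) \<le> c" by blast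
      then show "enat (card (carried us)) \<le> c" by (simp add: B *)
    qed
  next
    assume r: ?r
    have "enat (card (carried (take k (map snd S)))) \<le> c" for k
      using r append_take_drop_id[of k "map snd S"] by metis
    then show ?l by (simp add: B)
  qed
  show ?thesis
    unfolding is_schedule_def feasible_order_def C D by (auto simp: actions_def)
qed

lemma filter_eq_appendE:
  assumes "filter P xs = us @ vs"
  obtains us' vs' where "xs = us' @ vs'" "us = filter P us'" "vs = filter P vs'"
  using assms
proof (induction us arbitrary: xs thesis)
  case Nil
  then show ?case by (metis append_Nil filter.simps(1))
next
  case (Cons u us)
  from Cons.prems(2) obtain as bs where 1:
    "xs = as @ u # bs" "\<forall>a\<in>set as. \<not> P a" "P u" "us @ vs = filter P bs"
    by (auto simp: filter_eq_Cons_iff)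
  obtain us' vs' where "bs = us' @ vs'" "us = filter P us'" "vs = filter P vs'"
    using Cons.IH[of bs] 1(4) by metis
  then show ?case
    using 1 by (intro Cons.prems(1)[of "as @ u # us'" vs']) auto
qed

text \<open>Only whole requests are removed, so pickups still precede deliveries, and each cut of
  the filtered list lifts to a cut of \<open>xs\<close> with at least the same load.\<close>

lemma feasible_order_filter:
  assumes "feasible_order c R xs" "R' \<subseteq> R"
  shows "feasible_order c R' (filter (\<lambda>x. x \<in> Pickup ` R' \<union> Deliver ` R') xs)"
    (is "feasible_order c R' (filter ?P xs)")
  unfolding feasible_order_def
proof (intro conjI allI impI)
  show "distinct (filter ?P xs)" using assms by (simp add: feasible_order_def)
  show "set (filter ?P xs) = Pickup ` R' \<union> Deliver ` R'"
    using assms by (auto simp: feasible_order_def)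
next
  fix us i vs assume "filter ?P xs = us @ Deliver i # vs"
  then obtain us' ws where 1: "xs = us' @ ws" "us = filter ?P us'" "filter ?P ws = Deliver i # vs"
    by (metis filter_eq_appendE)
  then obtain ws1 ws2 where 2: "ws = ws1 @ Deliver i # ws2" "i \<in> R'" "\<forall>u\<in>set ws1. \<not> ?P u"
    by (auto simp: filter_eq_Cons_iff)
  then have "Pickup i \<in> set (us' @ ws1)"
    using assms(1) 1(1) unfolding feasible_order_def by (metis append.assoc)
  then show "Pickup i \<in> set us" using 1 2 by auto
next
  fix us vs assume "filter ?P xs = us @ vs"
  then obtain us' ws where 1: "xs = us' @ ws" "us = filter ?P us'"
    by (metis filter_eq_appendE)
  have "finite (carried us')"
    by (rule finite_subset[of _ "Pickup -` set us'"])
       (auto simp: carried_def intro!: finite_vimageI injI)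
  moreover have "carried us \<subseteq> carried us'"
    unfolding carried_def 1(2) by auto
  ultimately have "card (carried us) \<le> card (carried us')" by (rule card_mono)
  moreover have "enat (card (carried us')) \<le> c"
    using assms(1) 1(1) unfolding feasible_order_def by blast
  ultimately show "enat (card (carried us)) \<le> c"
    by (meson enat_ord_simps(1) order_trans)
qed

text \<open>Serving the requests one at a time never needs more than one seat.\<close>

lemma feasible_order_exists:
  assumes "finite R" "c \<ge> 1"
  shows "\<exists>xs. feasible_order c R xs"
  using assms(1)
proof (induction R)
  case empty
  have "feasible_order c {} []" by (simp add: feasible_order_def carried_def zero_enat_def[symmetric])
  then show ?case by blast
next
  case (insert j R)
  then obtain xs where xs: "feasible_order c R xs" by blast
  have empty: "carried xs = {}" using xs by (auto simp: feasible_order_def carried_def)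
  have new: "Pickup j \<notin> set xs" "Deliver j \<notin> set xs" 
    using xs insert by (auto simp: feasible_order_def)
  have c1: "carried (xs @ [Pickup j]) = {j}"
    using empty new by (auto simp: carried_def)
  have c2: "carried (xs @ [Pickup j, Deliver j]) = {}"
    using empty by (auto simp: carried_def)
  have "feasible_order c (insert j R) (xs @ [Pickup j, Deliver j])"
    unfolding feasible_order_def
  proof (intro conjI allI impI)
    show "distinct (xs @ [Pickup j, Deliver j])" using xs new by (auto simp: feasible_order_def)
    show "set (xs @ [Pickup j, Deliver j]) = Pickup ` insert j R \<union> Deliver ` insert j R"
      using xs by (auto simp: feasible_order_def)
  next
    fix us i vs assume *: "xs @ [Pickup j, Deliver j] = us @ Deliver i # vs"
    show "Pickup i \<in> set us"
    proof (cases vs rule: rev_cases)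
      case Nil
      then have "(xs @ [Pickup j]) @ [Deliver j] = us @ [Deliver i]"
        using * by (simp only: append_assoc append_Cons append_Nil)
      then have "xs @ [Pickup j] = us \<and> Deliver j = Deliver i" by (metis append1_eq_conv)
      then show ?thesis by auto
    next
      case (snoc vs' y)
      then have "(xs @ [Pickup j]) @ [Deliver j] = (us @ Deliver i # vs') @ [y]" using * by simp
      then have **: "xs @ [Pickup j] = us @ Deliver i # vs'" by (simp only: append1_eq_conv)
      show ?thesis
      proof (cases vs' rule: rev_cases)
        case (snoc ws z)
        then have "xs @ [Pickup j] = (us @ Deliver i # ws) @ [z]" using ** by simp
        then have "xs = us @ Deliver i # ws" by (simp only: append1_eq_conv)
        then show ?thesis using xs by (auto simp: feasible_order_def)
      qed (use ** in simp)
    qed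
  next
    fix us vs assume *: "xs @ [Pickup j, Deliver j] = us @ vs"
    \<comment> \<open>The cut lies inside \<open>xs\<close>, where the load is bounded by induction,
      or in the new tail, where the load is \<open>{j}\<close> or empty.\<close>
    have "(\<exists>ws. xs = us @ ws) \<or> us = xs @ [Pickup j] \<or> us = xs @ [Pickup j, Deliver j]"
    proof (cases vs rule: rev_cases)
      case (snoc vs' y)
      then have "(xs @ [Pickup j]) @ [Deliver j] = (us @ vs') @ [y]" using * by simp
      then have **: "xs @ [Pickup j] = us @ vs'" by (simp only: append1_eq_conv)
      show ?thesis
      proof (cases vs' rule: rev_cases)
        case (snoc ws z)
        then have "xs @ [Pickup j] = (us @ ws) @ [z]" using ** by simp
        then have "xs = us @ ws" by (simp only: append1_eq_conv)
        then show ?thesis by blast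
      qed (use ** in simp)
    qed (use * in simp)
    then show "enat (card (carried us)) \<le> c"
      using xs c1 c2 assms(2)
      by (auto simp: feasible_order_def zero_enat_def[symmetric] one_enat_def)
  qed
  then show ?case by blast
qed

section \<open>Earliest timing of an order, and existence of shortest schedules\<close>

fun ready_time :: "request list \<Rightarrow> real \<Rightarrow> action \<Rightarrow> real" where
  "ready_time \<sigma> t (Pickup i) = max t (rel_time (\<sigma> ! i))"
| "ready_time \<sigma> t (Deliver i) = t"

fun greedy :: "request list \<Rightarrow> real \<Rightarrow> real \<Rightarrow> action list \<Rightarrow> schedule" where
  "greedy \<sigma> t p [] = []"
| "greedy \<sigma> t p (x # xs) =
     (let s = ready_time \<sigma> (t + \<bar>location \<sigma> x - p\<bar>) x in (s, x) # greedy \<sigma> s (location \<sigma> x) xs)"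

lemma ready_time: "t \<le> ready_time \<sigma> t x" "earliest \<sigma> x (ready_time \<sigma> t x)"
  by (cases x; simp)+

lemma ready_time_le: "t \<le> s \<Longrightarrow> earliest \<sigma> x s \<Longrightarrow> ready_time \<sigma> t x \<le> s"
  by (cases x) auto

lemma map_snd_greedy [simp]: "map snd (greedy \<sigma> t p xs) = xs"
  by (induction \<sigma> t p xs rule: greedy.induct) (auto simp: Let_def)

lemma greedy_eq_Nil [simp]: "greedy \<sigma> t p xs = [] \<longleftrightarrow> xs = []"
  by (cases xs) (auto simp: Let_def)

lemma executable_greedy: "executable \<sigma> t p (greedy \<sigma> t p xs)"
proof (induction \<sigma> t p xs rule: greedy.induct)
  case (2 \<sigma> t p x xs)
  then show ?case using ready_time(1)[of "t + \<bar>location \<sigma> x - p\<bar>" \<sigma> x] ready_time(2)[of \<sigma> x] by (simp add: Let_def)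
qed simp

text \<open>By induction the greedy server is never behind \<open>S\<close>. The start time
  \<open>t\<close> is generalised because it may get ahead after the first action.\<close>

lemma last_greedy_le:
  assumes "executable \<sigma> t' p S" "t \<le> t'" "S \<noteq> []"
  shows "fst (last (greedy \<sigma> t p (map snd S))) \<le> fst (last S)"
  using assms
proof (induction \<sigma> t' p S arbitrary: t rule: executable.induct)
  case (2 \<sigma> t' p s x S)
  have "ready_time \<sigma> (t + \<bar>location \<sigma> x - p\<bar>) x \<le> s"
    using 2(2,3) by (intro ready_time_le) auto
  then show ?case using 2 by (auto simp: Let_def)
qed simp

text \<open>There are infinitely many timings but only finitely many orders, and the greedy timing
  is best for each order; so the minimum is attained.\<close>

lemma shortest_schedule_exists:
  assumes "finite R" "c \<ge> 1"
  obtains S where "shortest_schedule c \<sigma> t p R S"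
proof -
  let ?X = "{xs. feasible_order c R xs}"
  let ?f = "\<lambda>xs. schedule_length t (greedy \<sigma> t p xs)"
  have "finite ?X"
    by (rule finite_subset[OF _ finite_subset_distinct[of "Pickup ` R \<union> Deliver ` R"]])
       (use assms(1) in \<open>auto simp: feasible_order_def\<close>)
  then have fin: "finite (?f ` ?X)" by simp
  have "?f ` ?X \<noteq> {}" using feasible_order_exists[OF assms] by blast
  then have "Min (?f ` ?X) \<in> ?f ` ?X" using fin by (rule Min_in[rotated])
  then obtain xs where xs: "feasible_order c R xs" "?f xs = Min (?f ` ?X)" by force
  have "shortest_schedule c \<sigma> t p R (greedy \<sigma> t p xs)"
    unfolding shortest_schedule_def
  proof (intro conjI allI impI)
    show "is_schedule c \<sigma> t p R (greedy \<sigma> t p xs)"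
      by (simp add: is_schedule_iff executable_greedy xs)
    fix S assume S: "is_schedule c \<sigma> t p R S"
    then have "?f xs \<le> ?f (map snd S)" using xs fin by (simp add: is_schedule_iff)
    also have "\<dots> \<le> schedule_length t S"
      using S last_greedy_le[of \<sigma> t p S t] by (auto simp: schedule_length_def is_schedule_iff)
    finally show "?f xs \<le> schedule_length t S" .
  qed
  then show ?thesis by (rule that)
qed

text \<open>\<open>LEAST\<close> over the reals is informative only if a minimum is attained; the
  shortest schedule attains it.\<close>

lemma L_eq_length:
  assumes "shortest_schedule c \<sigma> t p R S"
  shows "L c \<sigma> t p R = schedule_length t S"
  unfolding L_def using assms
  by (intro Least_equality) (auto simp: shortest_schedule_def)

lemma L_le_length:
  assumes "finite R" "c \<ge> 1" "is_schedule c \<sigma> t p R S"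
  shows "L c \<sigma> t p R \<le> schedule_length t S"
proof -
  obtain S0 where "shortest_schedule c \<sigma> t p R S0" using assms shortest_schedule_exists by blast
  then show ?thesis using assms(3) L_eq_length by (metis shortest_schedule_def)
qed

section \<open>Events, end position and detours of a schedule\<close>

lemma schedule_nonempty: "is_schedule c \<sigma> t p R S \<Longrightarrow> R \<noteq> {} \<Longrightarrow> S \<noteq> []"
  by (auto simp: is_schedule_def actions_def)

lemma schedule_event:
  assumes "is_schedule c \<sigma> t p R S" "x \<in> Pickup ` R \<union> Deliver ` R"
  obtains s where "(s, x) \<in> set S"
proof -
  have "x \<in> snd ` set S" using assms by (simp add: is_schedule_def actions_def)
  then show ?thesis using that by auto
qed

lemma schedule_event_action:
  assumes "is_schedule c \<sigma> t p R S" "(s, x) \<in> set S"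
  shows "x \<in> Pickup ` R \<union> Deliver ` R"
proof -
  have "x \<in> snd ` set S" using assms(2) by force
  then show ?thesis using assms(1) by (simp add: is_schedule_def actions_def)
qed

lemma release_le_event:
  assumes "is_schedule c \<sigma> t p R S" "(s, x) \<in> set S" "x = Pickup i \<or> x = Deliver i"
  shows "rel_time (\<sigma> ! i) \<le> s"
proof (cases "x = Pickup i")
  case True
  then show ?thesis using executable_event[of \<sigma> t p S s x] assms by (auto simp: is_schedule_iff)
next
  case False
  then have x: "x = Deliver i" using assms(3) by blast
  obtain us vs where S: "S = us @ (s, x) # vs" using assms(2) by (meson split_list)
  then have "map snd S = map snd us @ Deliver i # map snd vs" using x by simp
  then have "Pickup i \<in> set (map snd us)"
    using assms(1) unfolding is_schedule_iff feasible_order_def by blast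
  then obtain s' where s': "(s', Pickup i) \<in> set us" by auto
  have ex: "executable \<sigma> t p (us @ (s, x) # vs)" using assms(1) S by (simp add: is_schedule_iff)
  \<comment> \<open>Cutting right after the delivery makes it the last event, hence no earlier than
    the pickup in \<open>us\<close>.\<close>
  have "executable \<sigma> t p (us @ [(s, x)])"
    using ex by (induction \<sigma> t p us rule: executable.induct) auto
  then have "s' \<le> s" using executable_le_last[of \<sigma> t p "us @ [(s, x)]" s' "Pickup i"] s' by simp
  moreover have "rel_time (\<sigma> ! i) \<le> s'"
    using executable_event[OF ex, of s' "Pickup i"] s' by simp
  ultimately show ?thesis by simp
qed

lemma end_position_eq_dst:
  assumes "is_schedule c \<sigma> t p R S" "R \<noteq> {}"
  obtains i where "i \<in> R" "snd (last S) = Deliver i" "end_position \<sigma> p S = dst (\<sigma> ! i)"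
proof -
  have ne: "S \<noteq> []" using schedule_nonempty[OF assms] .
  then have last: "last S \<in> set S" by simp
  have "snd (last S) \<in> Pickup ` R \<union> Deliver ` R"
    using schedule_event_action[OF assms(1), of "fst (last S)" "snd (last S)"] last by simp
  moreover have "snd (last S) \<noteq> Pickup j" if "j \<in> R" for j
  proof
    assume P: "snd (last S) = Pickup j"
    have dist: "distinct (map snd S)"
      and ord: "\<And>us i vs. map snd S = us @ Deliver i # vs \<Longrightarrow> Pickup i \<in> set us"
      and acts: "set (map snd S) = Pickup ` R \<union> Deliver ` R"
      using assms(1) unfolding is_schedule_iff feasible_order_def by blast+
    have "Deliver j \<in> set (map snd S)" using acts that by blast
    then obtain us vs where split: "map snd S = us @ Deliver j # vs" by (meson split_list)
    have "Pickup j \<in> set us" using ord[OF split] .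
    moreover have "last (us @ Deliver j # vs) = Pickup j"
      using P ne split by (metis last_map)
    \<comment> \<open>A final \<open>Pickup j\<close> would occur a second time, after
      \<open>Deliver j\<close>, against distinctness.\<close>
    then have "Pickup j \<in> set (Deliver j # vs)" by (metis last_appendR last_in_set list.discI)
    ultimately show False using dist split by auto
  qed
  ultimately obtain i where "i \<in> R" "snd (last S) = Deliver i" by blast
  then show ?thesis using that ne by (auto simp: end_position_def)
qed

lemma schedule_length_ge_detour:
  assumes "is_schedule c \<sigma> t p R S" "x \<in> Pickup ` R \<union> Deliver ` R"
  shows "\<bar>location \<sigma> x - p\<bar> + \<bar>location \<sigma> x - end_position \<sigma> p S\<bar> \<le> schedule_length t S"
proof -
  obtain s where s: "(s, x) \<in> set S" using schedule_event[OF assms] .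
  then have ne: "S \<noteq> []" by auto
  have ex: "executable \<sigma> t p S" using assms(1) by (simp add: is_schedule_iff)
  have "(fst (last S), snd (last S)) \<in> set S" using ne by simp
  from executable_Lipschitz[OF ex s this] executable_event[OF ex s] executable_le_last[OF ex s]
  show ?thesis using ne by (simp add: schedule_length_def end_position_def)
qed

lemma end_position_le_length:
  assumes "is_schedule c \<sigma> t p R S"
  shows "\<bar>end_position \<sigma> p S - p\<bar> \<le> schedule_length t S"
proof (cases "S = []")
  case False
  then show ?thesis
    using executable_event[of \<sigma> t p S "fst (last S)" "snd (last S)"] assms
    by (simp add: is_schedule_iff schedule_length_def end_position_def)
qed (simp add: schedule_length_def end_position_def)

section \<open>Reusing a schedule from another time and place\<close>

lemma restart_schedule:
  assumes "is_schedule c \<sigma> t p R S" "S \<noteq> []" "\<forall>i\<in>R. rel_time (\<sigma> ! i) \<le> t'"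
  obtains S' where "is_schedule c \<sigma> t' p' R S'"
    "schedule_length t' S' = \<bar>p' - location \<sigma> (snd (hd S))\<bar> + fst (last S) - fst (hd S)"
proof -
  obtain \<tau> x S1 where S: "S = (\<tau>, x) # S1" using assms(2) by (cases S) auto
  \<comment> \<open>This shift, possibly negative, places the first action at the moment of arrival
    from \<open>p'\<close>. All shifted times are at least \<open>t'\<close>, when everything in
    \<open>R\<close> is released.\<close>
  define d where "d = t' + \<bar>p' - location \<sigma> x\<bar> - \<tau>"
  have ex: "executable \<sigma> \<tau> (location \<sigma> x) S1" using assms(1) S by (simp add: is_schedule_iff)
  have early: "earliest \<sigma> y (s + d)" if y: "(s, y) \<in> set S" for s y
  proof -
    have "\<tau> \<le> s" using executable_event[OF ex, of s y] that S by auto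
    then have "t' \<le> s + d" by (simp add: d_def)
    moreover have "y \<in> Pickup ` R \<union> Deliver ` R" using schedule_event_action[OF assms(1) y] .
    ultimately show ?thesis using assms(3) by fastforce
  qed
  have "executable \<sigma> (\<tau> + d) (location \<sigma> x) (delay d S1)"
    by (rule executable_delay[OF ex]) (use early S in auto)
  then have "executable \<sigma> t' p' (delay d S)"
    using early[of \<tau> x] S by (simp add: delay_def d_def algebra_simps abs_minus_commute)
  then have "is_schedule c \<sigma> t' p' R (delay d S)"
    using assms(1) by (simp add: is_schedule_iff)
  moreover have "schedule_length t' (delay d S) =
      \<bar>p' - location \<sigma> (snd (hd S))\<bar> + fst (last S) - fst (hd S)"
    using assms(2) by (simp add: schedule_length_def last_delay S d_def)
  ultimately show ?thesis by (rule that)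
qed

lemma restrict_schedule:
  assumes "is_schedule c \<sigma> t p R0 P" "R \<subseteq> R0"
  shows "is_schedule c \<sigma> t p R (filter (\<lambda>e. snd e \<in> Pickup ` R \<union> Deliver ` R) P)"
proof -
  have "map snd (filter (\<lambda>e. snd e \<in> Pickup ` R \<union> Deliver ` R) P) =
      filter (\<lambda>x. x \<in> Pickup ` R \<union> Deliver ` R) (map snd P)"
    by (simp add: filter_map comp_def)
  then show ?thesis
    using assms executable_filter feasible_order_filter unfolding is_schedule_iff by metis
qed

text \<open>Restrict \<open>P\<close> to \<open>R\<close>, then restart it. Start time and position
  are quantified in the conclusion so that \<open>\<tau>\<close>, \<open>x\<close> and
  \<open>C\<close> depend on \<open>P\<close> and \<open>R\<close> only; \<open>z\<close> feeds the
  detour argument.\<close>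

lemma follow_schedule:
  assumes "is_schedule c \<sigma> t p R0 P" "R \<subseteq> R0" "R \<noteq> {}"
  obtains \<tau> x C z where
    "(\<tau>, x) \<in> set P" "\<exists>i\<in>R. rel_time (\<sigma> ! i) \<le> \<tau>"
    "(C, z) \<in> set P" "z \<in> Pickup ` R \<union> Deliver ` R"
    "\<And>t' p'. \<forall>i\<in>R. rel_time (\<sigma> ! i) \<le> t' \<Longrightarrow>
       \<exists>S. is_schedule c \<sigma> t' p' R S \<and> schedule_length t' S = \<bar>p' - location \<sigma> x\<bar> + C - \<tau>"
proof -
  define Q where "Q = filter (\<lambda>e. snd e \<in> Pickup ` R \<union> Deliver ` R) P"
  have Q: "is_schedule c \<sigma> t p R Q" unfolding Q_def by (rule restrict_schedule[OF assms(1,2)])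
  have ne: "Q \<noteq> []" using schedule_nonempty[OF Q assms(3)] .
  define \<tau> x C z where "\<tau> = fst (hd Q)" and "x = snd (hd Q)" and "C = fst (last Q)" and "z = snd (last Q)"
  have first: "(\<tau>, x) \<in> set Q" and last: "(C, z) \<in> set Q"
    using ne by (simp_all add: \<tau>_def x_def C_def z_def)
  then have mem: "x \<in> Pickup ` R \<union> Deliver ` R" "z \<in> Pickup ` R \<union> Deliver ` R"
    using schedule_event_action[OF Q] by blast+
  then have "\<exists>i\<in>R. rel_time (\<sigma> ! i) \<le> \<tau>" using release_le_event[OF Q first] by blast
  moreover have "(\<tau>, x) \<in> set P" "(C, z) \<in> set P" using first last by (auto simp: Q_def)
  moreover have "\<exists>S. is_schedule c \<sigma> t' p' R S \<and> schedule_length t' S = \<bar>p' - location \<sigma> x\<bar> + C - \<tau>"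
    if "\<forall>i\<in>R. rel_time (\<sigma> ! i) \<le> t'" for t' p'
    using restart_schedule[OF Q ne that] unfolding \<tau>_def x_def C_def by metis
  ultimately show ?thesis using mem that by metis
qed

text \<open>A schedule needs at least the travel time to its first action, so restarting it at
  \<open>s'\<close> cannot lengthen it. As \<open>s\<close> and \<open>s'\<close> are in no fixed
  order, \<open>L\<close> is constant once all of \<open>R\<close> is released.\<close>

lemma L_mono_start:
  assumes "finite R" "R \<noteq> {}" "c \<ge> 1" "\<forall>i\<in>R. rel_time (\<sigma> ! i) \<le> s'"
  shows "L c \<sigma> s' p R \<le> L c \<sigma> s p R"
proof -
  obtain S where S: "shortest_schedule c \<sigma> s p R S"
    using assms shortest_schedule_exists by blast
  then have S': "is_schedule c \<sigma> s p R S" by (simp add: shortest_schedule_def)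
  then have ne: "S \<noteq> []" using schedule_nonempty assms(2) by blast
  obtain S2 where S2: "is_schedule c \<sigma> s' p R S2"
    "schedule_length s' S2 = \<bar>p - location \<sigma> (snd (hd S))\<bar> + fst (last S) - fst (hd S)"
    using restart_schedule[OF S' ne assms(4)] .
  have "\<bar>location \<sigma> (snd (hd S)) - p\<bar> \<le> fst (hd S) - s"
    using executable_event[of \<sigma> s p S "fst (hd S)" "snd (hd S)"] S' ne by (simp add: is_schedule_iff)
  then have "schedule_length s' S2 \<le> schedule_length s S"
    using S2 ne by (simp add: schedule_length_def[of s S])
  moreover have "L c \<sigma> s' p R \<le> schedule_length s' S2"
    using L_le_length assms S2 by blast
  ultimately show ?thesis using L_eq_length[OF S] by simp
qed

lemma L_released_eq:
  assumes "finite R" "R \<noteq> {}" "c \<ge> 1" "\<forall>i\<in>R. rel_time (\<sigma> ! i) \<le> s" "\<forall>i\<in>R. rel_time (\<sigma> ! i) \<le> s'"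
  shows "L c \<sigma> s p R = L c \<sigma> s' p R"
  using L_mono_start[OF assms(1-3)] assms(4,5) by (meson order_antisym)

section \<open>Runs of Smartstart\<close>

text \<open>While the released set is unchanged so is \<open>L\<close>, and the start condition is a
  mere lower bound on time. Hence \<open>s\<close> can slide down to the largest of
  \<open>t\<close>, the release times and the length bound.\<close>

lemma may_start_earlier:
  assumes "finite U" "c \<ge> 1" "may_start c \<Theta> \<sigma> p U s" "t \<le> s"
  obtains s' where "t \<le> s'" "s' \<le> s" "may_start c \<Theta> \<sigma> p U s'"
    "s' = t \<or> (\<exists>i\<in>released \<sigma> U s. s' = rel_time (\<sigma> ! i)) \<or>
     s' = L c \<sigma> s p (released \<sigma> U s) / (\<Theta> - 1)"
proof -
  let ?R = "released \<sigma> U s" and ?r = "\<lambda>i. rel_time (\<sigma> ! i)"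
  let ?l = "L c \<sigma> s p ?R / (\<Theta> - 1)"
  let ?X = "insert t (insert ?l (?r ` ?R))"
  have fin: "finite ?R" using assms(1) by (simp add: released_def)
  define s' where "s' = Max ?X"
  have "s' \<in> ?X" unfolding s'_def by (rule Max_in) (use fin in auto)
  have ub: "y \<le> s'" if "y \<in> ?X" for y unfolding s'_def by (rule Max_ge) (use fin that in auto)
  have ne: "?R \<noteq> {}" and l: "?l \<le> s" using assms(3) by (auto simp: may_start_def)
  have r: "\<forall>i\<in>?R. ?r i \<le> s" by (auto simp: released_def)
  have "s' \<le> s" using \<open>s' \<in> ?X\<close> l r assms(4) by auto
  have r': "\<forall>i\<in>?R. ?r i \<le> s'" using ub by blast
  have "released \<sigma> U s' = ?R"
    using r' \<open>s' \<le> s\<close> by (auto simp: released_def)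
  moreover have "L c \<sigma> s' p ?R = L c \<sigma> s p ?R"
    by (rule L_released_eq[OF fin ne assms(2) r' r])
  ultimately have "may_start c \<Theta> \<sigma> p U s'" using ne ub[of ?l] by (simp add: may_start_def)
  then show ?thesis using that[of s'] ub[of t] \<open>s' \<le> s\<close> \<open>s' \<in> ?X\<close> by auto
qed

text \<open>Sliding down any admissible time lands in a finite set of candidates, whose minimum is
  the required start.\<close>

lemma earliest_start_exists:
  assumes "finite U" "U \<noteq> {}" "c \<ge> 1"
  obtains s where "t \<le> s" "may_start c \<Theta> \<sigma> p U s"
    "\<And>s'. t \<le> s' \<Longrightarrow> may_start c \<Theta> \<sigma> p U s' \<Longrightarrow> s \<le> s'"
proof -
  let ?r = "\<lambda>i. rel_time (\<sigma> ! i)"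
  \<comment> \<open>By time \<open>m\<close> all of \<open>U\<close> is released, so
    \<open>L\<close> evaluated at \<open>m\<close> represents every subset independently of the
    start time.\<close>
  define m where "m = Max (insert t (?r ` U))"
  have m: "t \<le> m" "\<forall>i\<in>U. ?r i \<le> m"
    unfolding m_def using assms(1) by (auto intro: Max_ge)
  define X where "X = {s \<in> insert t (?r ` U \<union> (\<lambda>R. L c \<sigma> m p R / (\<Theta> - 1)) ` Pow U).
      t \<le> s \<and> may_start c \<Theta> \<sigma> p U s}"
  have "finite X" using assms(1) by (simp add: X_def)
  have below: "\<exists>x\<in>X. x \<le> s" if s: "t \<le> s" "may_start c \<Theta> \<sigma> p U s" for s
  proof -
    let ?R = "released \<sigma> U s"
    obtain s' where s': "t \<le> s'" "s' \<le> s" "may_start c \<Theta> \<sigma> p U s'"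
      "s' = t \<or> (\<exists>i\<in>?R. s' = ?r i) \<or> s' = L c \<sigma> s p ?R / (\<Theta> - 1)"
      using may_start_earlier[OF assms(1,3) s(2,1)] .
    have sub: "?R \<subseteq> U" by (auto simp: released_def)
    have "L c \<sigma> s p ?R = L c \<sigma> m p ?R"
      by (rule L_released_eq)
         (use assms s(2) m sub in \<open>auto simp: released_def may_start_def intro: finite_subset\<close>)
    then have "s' \<in> X" using s' sub unfolding X_def by auto
    then show ?thesis using s'(2) by blast
  qed
  define s1 where "s1 = max m (L c \<sigma> m p U / (\<Theta> - 1))"
  have s1: "released \<sigma> U s1 = U" "t \<le> s1" using m by (auto simp: s1_def released_def)
  have "L c \<sigma> s1 p U = L c \<sigma> m p U"
    by (rule L_released_eq) (use assms m s1_def in \<open>auto simp: le_max_iff_disj\<close>)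
  then have "may_start c \<Theta> \<sigma> p U s1" using s1 assms(2) by (simp add: may_start_def s1_def)
  then have "X \<noteq> {}" using below s1 by blast
  then have "Min X \<in> X" using \<open>finite X\<close> by simp
  show ?thesis
  proof (rule that[of "Min X"])
    show "t \<le> Min X" "may_start c \<Theta> \<sigma> p U (Min X)" using \<open>Min X \<in> X\<close> by (auto simp: X_def)
    show "Min X \<le> s'" if "t \<le> s'" "may_start c \<Theta> \<sigma> p U s'" for s'
      using below[OF that] \<open>finite X\<close> by (meson Min_le order_trans)
  qed
qed

text \<open>Each round serves a nonempty set, so the unserved set strictly shrinks.\<close>

lemma smartstart_from_exists:
  assumes "finite U" "c \<ge> 1"
  shows "\<exists>T. smartstart_from c \<Theta> \<sigma> t p U T"
  using assms(1)
proof (induction U arbitrary: t p rule: finite_psubset_induct)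
  case (psubset U)
  show ?case
  proof (cases "U = {}")
    case False
    obtain s where s: "t \<le> s" "may_start c \<Theta> \<sigma> p U s"
      "\<And>s'. t \<le> s' \<Longrightarrow> may_start c \<Theta> \<sigma> p U s' \<Longrightarrow> s \<le> s'"
      using earliest_start_exists[OF psubset(1) False assms(2),
          where t = t and \<Theta> = \<Theta> and \<sigma> = \<sigma> and p = p] by blast
    let ?R = "released \<sigma> U s"
    have "?R \<subseteq> U" by (auto simp: released_def)
    then have fin: "finite ?R" using psubset(1) by (rule finite_subset)
    have "U - ?R \<subset> U" using s(2) \<open>?R \<subseteq> U\<close> by (auto simp: may_start_def)
    moreover obtain S where S: "shortest_schedule c \<sigma> s p ?R S"
      using shortest_schedule_exists[OF fin assms(2)] .
    ultimately obtain T where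
      "smartstart_from c \<Theta> \<sigma> (s + schedule_length s S) (end_position \<sigma> p S) (U - ?R) T"
      using psubset(2) by blast
    then show ?thesis using smartstart_from.round[OF s S] by blast
  qed (use smartstart_from.finished in blast)
qed

lemma start_after_previous_round:
  assumes "finite U" "c \<ge> 1" "may_start c \<Theta> \<sigma> p U s" "t \<le> s"
    "\<And>s'. t \<le> s' \<Longrightarrow> may_start c \<Theta> \<sigma> p U s' \<Longrightarrow> s \<le> s'"
  shows "s = t \<or> (\<exists>i\<in>U. s = rel_time (\<sigma> ! i)) \<or> s = L c \<sigma> s p (released \<sigma> U s) / (\<Theta> - 1)"
proof -
  obtain s' where s': "t \<le> s'" "s' \<le> s" "may_start c \<Theta> \<sigma> p U s'"
    "s' = t \<or> (\<exists>i\<in>released \<sigma> U s. s' = rel_time (\<sigma> ! i)) \<or>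
     s' = L c \<sigma> s p (released \<sigma> U s) / (\<Theta> - 1)"
    using may_start_earlier[OF assms(1-4)] .
  with assms(5) have "s = s'" by force
  then show ?thesis using s'(4) by (auto simp: released_def)
qed

section \<open>Arithmetic of the two cases\<close>

text \<open>Here \<open>z\<close> is the optimum, which visits \<open>p\<close> at time \<open>u\<close> and first picks up a request of the
  round at time \<open>\<tau>\<close> in \<open>a\<close>; the previous round started at time \<open>t\<close>.\<close>

lemma detour_bound:
  fixes \<Theta> p a \<tau> u t z :: real
  assumes "\<Theta> \<ge> 0" "0 \<le> \<tau>" "\<tau> \<le> z" "u \<le> z" "t \<le> \<tau>" "\<bar>a\<bar> \<le> \<tau>"
    "\<bar>p - a\<bar> \<le> \<bar>u - \<tau>\<bar>" "0 \<le> u" "\<bar>p\<bar> \<le> \<Theta> * t"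
  shows "(\<Theta> + 2) * (\<bar>p - a\<bar> + z - \<tau>) \<le> (2 * \<Theta> + 2) * z"
proof -
  \<comment> \<open>\<open>E\<close> is the excess over \<open>z\<close>; the claim amounts to
    \<open>(\<Theta> + 2) * E \<le> \<Theta> * z\<close>.\<close>
  define E where "E = \<bar>p - a\<bar> - \<tau>"
  have "\<Theta> * t \<le> \<Theta> * \<tau>" using assms by (intro mult_left_mono) auto
  then have "E \<le> \<Theta> * \<tau>" using assms unfolding E_def by linarith
  have "(\<Theta> + 2) * E \<le> \<Theta> * z"
  proof (cases "u \<le> \<tau>")
    case True
    then have "E \<le> 0" using assms unfolding E_def by linarith
    then have "(\<Theta> + 2) * E \<le> 0" using assms(1) by (simp add: mult_nonneg_nonpos)
    moreover have "0 \<le> \<Theta> * z" using assms by simp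
    ultimately show ?thesis by linarith
  next
    case False
    then have "E \<le> z - 2 * \<tau>" using assms unfolding E_def by linarith
    \<comment> \<open>Adding twice the bound \<open>E \<le> \<Theta> * \<tau>\<close> cancels
      \<open>\<tau>\<close>.\<close>
    then have "\<Theta> * E \<le> \<Theta> * (z - 2 * \<tau>)" using assms(1) by (rule mult_left_mono)
    then show ?thesis using \<open>E \<le> \<Theta> * \<tau>\<close> by (simp add: algebra_simps)
  qed
  then show ?thesis unfolding E_def by (simp add: algebra_simps)
qed

text \<open>A start at \<open>l / (\<Theta> - 1)\<close> gives completion time
  \<open>\<Theta> * l / (\<Theta> - 1)\<close>, which is where \<open>f1\<close> comes from; a start
  by time \<open>z\<close> is no worse for such \<open>\<Theta>\<close>.\<close>

lemma waiting_bound: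
  assumes "1 < \<Theta>" "\<Theta> \<le> 5/2" "0 \<le> z" "(\<Theta> + 2) * l \<le> (2 * \<Theta> + 2) * z"
    "s \<le> z \<or> s = l / (\<Theta> - 1)"
  shows "s + l \<le> f1 \<Theta> * z"
proof -
  have f1: "f1 \<Theta> = (2 * \<Theta> + 2) * \<Theta> / ((\<Theta> - 1) * (\<Theta> + 2))"
    by (simp add: f1_def power2_eq_square algebra_simps)
  have pos: "0 < (\<Theta> - 1) * (\<Theta> + 2)" using assms(1) by simp
  have "(s + l) * ((\<Theta> - 1) * (\<Theta> + 2)) \<le> (2 * \<Theta> + 2) * \<Theta> * z"
    using assms(5)
  proof
    assume "s \<le> z"
    have 1: "(\<Theta> - 1) * (\<Theta> + 2) * s \<le> (\<Theta> - 1) * (\<Theta> + 2) * z"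
      using \<open>s \<le> z\<close> pos by (intro mult_left_mono) auto
    have 2: "(\<Theta> - 1) * ((\<Theta> + 2) * l) \<le> (\<Theta> - 1) * ((2 * \<Theta> + 2) * z)"
      using assms by (intro mult_left_mono) auto
    \<comment> \<open>After clearing denominators the inequality reduces to
      \<open>\<Theta> * (\<Theta> - 1) \<le> 4\<close>.\<close>
    have "\<Theta> * (\<Theta> - 1) \<le> 5/2 * (3/2)" using assms by (intro mult_mono) auto
    then have "0 \<le> (4 - \<Theta> * (\<Theta> - 1)) * z" using assms(3) by simp
    then show ?thesis using 1 2 by (simp add: algebra_simps)
  next
    assume s: "s = l / (\<Theta> - 1)"
    then have "(s + l) * ((\<Theta> - 1) * (\<Theta> + 2)) = \<Theta> * ((\<Theta> + 2) * l)"
      using assms(1) by (simp add: field_simps)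
    also have "\<dots> \<le> \<Theta> * ((2 * \<Theta> + 2) * z)" using assms by (intro mult_left_mono) auto
    finally show ?thesis by (simp add: algebra_simps)
  qed
  then show ?thesis using pos by (simp add: f1 field_simps)
qed

text \<open>The previous round has start time \<open>t\<close>, start position \<open>q\<close> and length \<open>l\<close>, and its requests
  are released after time \<open>\<beta>\<close>; the optimum \<open>O'\<close> finishes them at time \<open>C\<close> in \<open>z\<close> and visits its end
  position \<open>p\<close> at time \<open>u\<close>. The current round has length \<open>l'\<close> and is started by the optimum
  at time \<open>\<tau>\<close> in \<open>a\<close>.\<close>

lemma not_waiting_bound:
  fixes \<Theta> t l l' O' \<tau> a p q \<beta> u C z :: real
  assumes \<Theta>: "2 \<le> \<Theta>" "\<Theta> \<le> 9/4"
    and l: "l \<le> (\<Theta> - 1) * t" "l \<le> \<bar>q\<bar> + C" "\<bar>z - q\<bar> + \<bar>z - p\<bar> \<le> l"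
    and l': "l' \<le> \<bar>p - a\<bar> + O' - \<tau>"
    and t: "t \<le> \<tau>" "\<tau> \<le> O'" "C \<le> O'" "u \<le> O'"
    and q: "\<bar>q\<bar> \<le> \<Theta> * \<beta>" "\<beta> \<le> u"
    and opt: "\<bar>p\<bar> \<le> u" "\<bar>p - a\<bar> \<le> \<bar>u - \<tau>\<bar>" "\<bar>z - a\<bar> \<le> \<bar>C - \<tau>\<bar>"
  shows "t + l + l' \<le> f2 \<Theta> * O'"
proof -
  define X where "X = t + l + l'"
  define \<eta> where "\<eta> = \<tau> - \<bar>p - a\<bar>"
  have K: "0 < 3 * \<Theta> + 3" using \<Theta> by simp
  have f2: "(3 * \<Theta> + 3) * (f2 \<Theta> * O') = (3 * \<Theta> + 3) * (\<Theta> + 1) * O' - (\<Theta> - 1) * O'"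
    using K by (simp add: f2_def divide_simps) (simp add: algebra_simps)
  have "0 \<le> O'" using opt t by linarith
  have t\<Theta>: "\<Theta> * t \<le> \<Theta> * \<tau>" "(\<Theta> - 2) * \<tau> \<le> (\<Theta> - 2) * O'"
    using \<Theta> t by (auto intro!: mult_left_mono)
  note abs = abs_ge_self[of "z - q"] abs_ge_minus_self[of "z - q"]
    abs_ge_self[of "z - p"] abs_ge_minus_self[of "z - p"]
    abs_ge_self[of "z - a"] abs_ge_minus_self[of "z - a"]
    abs_ge_self[of p] abs_ge_minus_self[of p] abs_ge_self[of q] abs_ge_minus_self[of q]
  have q\<Theta>: "\<bar>q\<bar> \<le> \<Theta> * u"
    using q mult_left_mono[of \<beta> u \<Theta>] \<Theta> by linarith
  have X1: "X \<le> \<Theta> * t + \<bar>p - a\<bar> + O' - \<tau>"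
    using l(1) l' unfolding X_def by (simp add: algebra_simps)
  have "(3 * \<Theta> + 3) * X \<le> (3 * \<Theta> + 3) * (\<Theta> + 1) * O' - (\<Theta> - 1) * O'"
  proof (cases "u \<le> \<tau>")
    case False
    \<comment> \<open>The optimum visits \<open>p\<close> after \<open>a\<close>, so
      \<open>\<bar>p - a\<bar> \<le> O' - \<tau>\<close>; \<open>\<Theta> \<ge> 2\<close> then
      absorbs \<open>\<tau>\<close> into \<open>O'\<close>.\<close>
    have "X \<le> \<Theta> * O'"
      using X1 opt(2) False t t\<Theta> by (simp add: algebra_simps)
    then have "(3 * \<Theta> + 3) * X \<le> (3 * \<Theta> + 3) * (\<Theta> * O')" using K by simp
    moreover have "0 \<le> (2 * \<Theta> + 4) * O'" using \<Theta> \<open>0 \<le> O'\<close> by simp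
    ultimately show ?thesis by (simp add: algebra_simps)
  next
    case True
    then have u: "u \<le> \<eta>" using opt(2) unfolding \<eta>_def by linarith
    then have "\<Theta> * u \<le> \<Theta> * \<eta>" using \<Theta> by simp
    then have q\<eta>: "\<bar>q\<bar> \<le> \<Theta> * \<eta>" using q\<Theta> by linarith
    have X2: "X \<le> \<Theta> * \<tau> + O' - \<eta>" using X1 t\<Theta> unfolding \<eta>_def by linarith
    show ?thesis
    proof (cases "C \<le> \<tau>")
      case True
      \<comment> \<open>On the side of \<open>a\<close>, \<open>z\<close> is at least
        \<open>C - \<eta>\<close> beyond \<open>p\<close>. Going to \<open>z\<close> and back to
        \<open>p\<close> costs at least
        \<open>2 * C - 2 * \<eta> - \<bar>p\<bar> - \<bar>q\<bar>\<close>, while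
        \<open>C \<ge> l - \<bar>q\<bar>\<close>.\<close>
      have "l \<le> 3 * \<bar>q\<bar> + 2 * \<eta> + \<bar>p\<bar>"
        using l(2,3) opt(3) True abs
        unfolding \<eta>_def by (cases "p \<le> a") simp_all
      then have "X \<le> 2 * O' + 3 * (\<Theta> * \<eta>) + 2 * \<eta>"
        using l' t q\<eta> opt(1) u unfolding X_def \<eta>_def by linarith
      moreover have "\<Theta> * \<tau> \<le> \<Theta> * O'" using \<Theta> t by simp
      then have "X \<le> \<Theta> * O' + O' - \<eta>" using X2 by linarith
      \<comment> \<open>Weights \<open>1\<close> and \<open>3 * \<Theta> + 2\<close> cancel
        \<open>\<eta>\<close>; their sum is the denominator in \<open>f2\<close>.\<close>
      then have "(3 * \<Theta> + 2) * X \<le> (3 * \<Theta> + 2) * (\<Theta> * O' + O' - \<eta>)"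
        using \<Theta> by (intro mult_left_mono) auto
      ultimately show ?thesis by (simp add: algebra_simps)
    next
      case False
      define \<epsilon> where "\<epsilon> = O' - \<tau>"
      \<comment> \<open>Now \<open>z\<close> is within \<open>\<epsilon>\<close> of
        \<open>a\<close>, so it is at least \<open>O' - 2 * \<epsilon> - \<eta>\<close> beyond
        \<open>p\<close>. The same detour is compared with
        \<open>l \<le> \<bar>q\<bar> + O'\<close>.\<close>
      have "O' \<le> 4 * \<epsilon> + 2 * \<eta> + 2 * \<bar>q\<bar> + \<bar>p\<bar>"
        using l(2,3) opt(3) t False abs
        unfolding \<eta>_def \<epsilon>_def by (cases "p \<le> a") simp_all
      then have "O' \<le> 4 * \<epsilon> + 3 * \<eta> + 2 * (\<Theta> * \<eta>)"
        using q\<eta> opt(1) u by linarith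
      moreover have "4 * \<epsilon> \<le> (3 + 2 * \<Theta>) * \<Theta> * \<epsilon>"
      proof (rule mult_right_mono)
        have "7 * 2 \<le> (3 + 2 * \<Theta>) * \<Theta>" using \<Theta> by (intro mult_mono) auto
        then show "4 \<le> (3 + 2 * \<Theta>) * \<Theta>" by simp
      qed (use t \<epsilon>_def in simp)
      ultimately have "O' \<le> (3 + 2 * \<Theta>) * (\<Theta> * \<epsilon> + \<eta>)" by (simp add: algebra_simps)
      moreover have "\<Theta> * \<epsilon> + \<eta> \<le> \<Theta> * O' + O' - X"
        using X2 unfolding \<epsilon>_def by (simp add: algebra_simps)
      then have "(3 + 2 * \<Theta>) * (\<Theta> * \<epsilon> + \<eta>) \<le> (3 + 2 * \<Theta>) * (\<Theta> * O' + O' - X)"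
        using \<Theta> by (intro mult_left_mono) auto
      ultimately have Y: "O' \<le> (3 + 2 * \<Theta>) * (\<Theta> * O' + O' - X)" by linarith
      \<comment> \<open>With this slack the goal reads
        \<open>(\<Theta> - 1) * O' \<le> (3 * \<Theta> + 3) * Y\<close>.\<close>
      define Y where "Y = \<Theta> * O' + O' - X"
      have "0 \<le> (3 + 2 * \<Theta>) * Y" using Y \<open>0 \<le> O'\<close> unfolding Y_def by linarith
      then have "0 \<le> Y" using \<Theta> by (simp add: zero_le_mult_iff)
      have "(\<Theta> - 1) * O' \<le> (\<Theta> - 1) * ((3 + 2 * \<Theta>) * Y)"
        using Y \<Theta> unfolding Y_def by (intro mult_left_mono) auto
      also have "\<dots> = ((\<Theta> - 1) * (3 + 2 * \<Theta>)) * Y" by simp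
      also have "\<dots> \<le> (3 * \<Theta> + 3) * Y"
      proof (rule mult_right_mono)
        \<comment> \<open>The comparison of factors needs
          \<open>\<Theta> * (\<Theta> - 1) \<le> 3\<close>; this is where
          \<open>\<Theta> \<le> 9/4\<close> enters.\<close>
        have "\<Theta> * (\<Theta> - 1) \<le> 9/4 * (5/4)" using \<Theta> by (intro mult_mono) auto
        then show "(\<Theta> - 1) * (3 + 2 * \<Theta>) \<le> 3 * \<Theta> + 3" by (simp add: algebra_simps)
      qed fact
      finally show ?thesis unfolding Y_def by (simp add: algebra_simps)
    qed
  qed
  then have "(3 * \<Theta> + 3) * X \<le> (3 * \<Theta> + 3) * (f2 \<Theta> * O')" using f2 by simp
  then show ?thesis using K by (simp add: X_def)
qed

section \<open>Upper bound\<close>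

text \<open>The time \<open>\<beta>\<close> is the start of the last completed round, or 0 before the first one.\<close>

definition idle_state :: "real \<Rightarrow> request list \<Rightarrow> real \<Rightarrow> real \<Rightarrow> real \<Rightarrow> nat set \<Rightarrow> bool" where
  "idle_state \<Theta> \<sigma> \<beta> t p U \<longleftrightarrow>
     U \<subseteq> {..<length \<sigma>} \<and> 0 \<le> \<beta> \<and> (\<forall>i\<in>U. \<beta> \<le> rel_time (\<sigma> ! i)) \<and> \<bar>p\<bar> \<le> \<Theta> * \<beta> \<and> \<bar>p\<bar> \<le> t"

text \<open>The start rule bounds the length, so the round ends by \<open>\<Theta> * s\<close>; what
  remains unserved is released after \<open>s\<close>, which becomes the new
  \<open>\<beta>\<close>.\<close>

lemma idle_state_round:
  assumes "1 < \<Theta>" "idle_state \<Theta> \<sigma> \<beta> t p U" "t \<le> s" "may_start c \<Theta> \<sigma> p U s"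
    "shortest_schedule c \<sigma> s p (released \<sigma> U s) S"
  shows "schedule_length s S \<le> (\<Theta> - 1) * s"
    "idle_state \<Theta> \<sigma> s (s + schedule_length s S) (end_position \<sigma> p S) (U - released \<sigma> U s)"
proof -
  show len: "schedule_length s S \<le> (\<Theta> - 1) * s"
    using assms(1,4) L_eq_length[OF assms(5)] by (simp add: may_start_def field_simps)
  have S: "is_schedule c \<sigma> s p (released \<sigma> U s) S"
    using assms(5) by (simp add: shortest_schedule_def)
  have p: "\<bar>p\<bar> \<le> s" using assms(2,3) by (simp add: idle_state_def)
  have e: "\<bar>end_position \<sigma> p S\<bar> \<le> s + schedule_length s S"
    using end_position_le_length[OF S] p by linarith
  also have "\<dots> \<le> \<Theta> * s" using len by (simp add: algebra_simps)
  finally show "idle_state \<Theta> \<sigma> s (s + schedule_length s S) (end_position \<sigma> p S) (U - released \<sigma> U s)"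
    using e p assms(2) by (auto simp: idle_state_def released_def)
qed

text \<open>The previous round is part of the hypotheses because without waiting the two rounds are
  estimated jointly, giving \<open>f2\<close>; with waiting its start time and end position suffice,
  giving \<open>f1\<close>.\<close>

lemma round_bound:
  assumes "c \<ge> 1" and \<Theta>: "2 \<le> \<Theta>" "\<Theta> \<le> 9/4"
    and P: "shortest_schedule c \<sigma> 0 0 {..<length \<sigma>} P"
    and prev: "idle_state \<Theta> \<sigma> \<beta> t0 q V" "t0 \<le> s1" "may_start c \<Theta> \<sigma> q V s1"
      "shortest_schedule c \<sigma> s1 q (released \<sigma> V s1) S1"
    and state: "t = s1 + schedule_length s1 S1" "p = end_position \<sigma> q S1" "U = V - released \<sigma> V s1"
    and this_round: "t \<le> s" "may_start c \<Theta> \<sigma> p U s"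
      "\<And>s'. t \<le> s' \<Longrightarrow> may_start c \<Theta> \<sigma> p U s' \<Longrightarrow> s \<le> s'"
      "shortest_schedule c \<sigma> s p (released \<sigma> U s) S"
  shows "s + schedule_length s S \<le> max (f1 \<Theta>) (f2 \<Theta>) * Opt c \<sigma>"
proof -
  define R1 R where "R1 = released \<sigma> V s1" and "R = released \<sigma> U s"
  define opt where "opt = Opt c \<sigma>"
  have V: "V \<subseteq> {..<length \<sigma>}" "0 \<le> \<beta>" "\<forall>i\<in>V. \<beta> \<le> rel_time (\<sigma> ! i)" "\<bar>q\<bar> \<le> \<Theta> * \<beta>"
    using prev(1) by (auto simp: idle_state_def)
  have R1: "R1 \<subseteq> {..<length \<sigma>}" "R1 \<noteq> {}" and R: "R \<subseteq> {..<length \<sigma>}" "R \<noteq> {}"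
    using V(1) prev(3) this_round(2) by (auto simp: R1_def R_def state released_def may_start_def)
  have S1: "is_schedule c \<sigma> s1 q R1 S1"
    using prev(4) by (simp add: R1_def shortest_schedule_def)
  have P': "is_schedule c \<sigma> 0 0 {..<length \<sigma>} P" using P by (simp add: shortest_schedule_def)
  then have ex: "executable \<sigma> 0 0 P" by (simp add: is_schedule_iff)
  have "P \<noteq> []" using schedule_nonempty[OF P'] R by blast
  then have opt: "opt = fst (last P)"
    using L_eq_length[OF P] by (simp add: opt_def Opt_def schedule_length_def)
  have le_opt: "u \<le> opt" if "(u, x) \<in> set P" for u x
    using executable_le_last[OF ex that] opt by simp
  have reach: "\<bar>location \<sigma> x\<bar> \<le> u" if "(u, x) \<in> set P" for u x
    using executable_event[OF ex that] by simp
  note lip = executable_Lipschitz[OF ex]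
  have s1: "\<forall>i\<in>U. s1 < rel_time (\<sigma> ! i)" using state(3) by (auto simp: released_def)
  obtain \<tau> x C0 z0 where N: "(\<tau>, x) \<in> set P" "\<exists>i\<in>R. rel_time (\<sigma> ! i) \<le> \<tau>" "(C0, z0) \<in> set P"
    "\<And>t' p'. \<forall>i\<in>R. rel_time (\<sigma> ! i) \<le> t' \<Longrightarrow>
       \<exists>S. is_schedule c \<sigma> t' p' R S \<and> schedule_length t' S = \<bar>p' - location \<sigma> x\<bar> + C0 - \<tau>"
    using follow_schedule[OF P' R] by metis
  define a where "a = location \<sigma> x"
  have "\<forall>i\<in>R. rel_time (\<sigma> ! i) \<le> s" by (auto simp: R_def released_def)
  then have "schedule_length s S \<le> \<bar>p - a\<bar> + C0 - \<tau>"
    using N(4) this_round(4) unfolding shortest_schedule_def R_def a_def by metis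
  then have l': "schedule_length s S \<le> \<bar>p - a\<bar> + opt - \<tau>" using le_opt[OF N(3)] by simp
  have "s1 \<le> \<tau>" using N(2) s1 by (force simp: R_def released_def)
  obtain \<tau>1 x1 C z where N1: "(\<tau>1, x1) \<in> set P" "(C, z) \<in> set P" "z \<in> Pickup ` R1 \<union> Deliver ` R1"
    "\<And>t' p'. \<forall>i\<in>R1. rel_time (\<sigma> ! i) \<le> t' \<Longrightarrow>
       \<exists>S. is_schedule c \<sigma> t' p' R1 S \<and> schedule_length t' S = \<bar>p' - location \<sigma> x1\<bar> + C - \<tau>1"
    using follow_schedule[OF P' R1] by metis
  have "\<forall>i\<in>R1. rel_time (\<sigma> ! i) \<le> s1" by (auto simp: R1_def released_def)
  then have "schedule_length s1 S1 \<le> \<bar>q - location \<sigma> x1\<bar> + C - \<tau>1"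
    using N1(4) prev(4) unfolding shortest_schedule_def R1_def by metis
  then have l: "schedule_length s1 S1 \<le> \<bar>q\<bar> + C" using reach[OF N1(1)] by linarith
  \<comment> \<open>The end position is a destination, so the optimum visits it too, at the time
    called \<open>u\<close> below.\<close>
  obtain i where i: "i \<in> R1" "p = dst (\<sigma> ! i)"
    using end_position_eq_dst[OF S1 R1(2)] state(2) by metis
  have "Deliver i \<in> Pickup ` {..<length \<sigma>} \<union> Deliver ` {..<length \<sigma>}" using i(1) R1(1) by blast
  then obtain u where u: "(u, Deliver i) \<in> set P" using schedule_event[OF P'] by blast
  have pu: "\<bar>p\<bar> \<le> u" "\<bar>p - a\<bar> \<le> \<bar>u - \<tau>\<bar>"
    using reach[OF u] lip[OF u N(1)] i(2) by (simp_all add: a_def)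
  have "rel_time (\<sigma> ! i) \<le> u" using release_le_event[OF P' u] by blast
  then have "\<beta> \<le> u" using V(3) i(1) by (force simp: R1_def released_def)
  have len1: "schedule_length s1 S1 \<le> (\<Theta> - 1) * s1"
    using idle_state_round(1)[OF _ prev] \<Theta> by simp
  show ?thesis
  proof (cases "s = t")
    case True
    have "s1 + schedule_length s1 S1 + schedule_length s S \<le> f2 \<Theta> * opt"
    proof (rule not_waiting_bound[OF \<Theta> len1 l _ l' \<open>s1 \<le> \<tau>\<close> le_opt[OF N(1)] le_opt[OF N1(2)]
          le_opt[OF u] V(4) \<open>\<beta> \<le> u\<close> pu])
      show "\<bar>location \<sigma> z - q\<bar> + \<bar>location \<sigma> z - p\<bar> \<le> schedule_length s1 S1"
        using schedule_length_ge_detour[OF S1 N1(3)] state(2) by simp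
      show "\<bar>location \<sigma> z - a\<bar> \<le> \<bar>C - \<tau>\<bar>" using lip[OF N1(2) N(1)] by (simp add: a_def)
    qed
    moreover have "0 \<le> opt" using le_opt[OF u] pu by linarith
    ultimately show ?thesis using True state(1) opt_def
      by (meson max.cobounded2 mult_right_mono order_trans eq_refl)
  next
    case False
    have "0 \<le> \<tau>" "\<bar>a\<bar> \<le> \<tau>" using reach[OF N(1)] by (auto simp: a_def)
    have "\<bar>p\<bar> \<le> \<Theta> * s1"
      using idle_state_round(2)[OF _ prev] \<Theta> state(2) by (simp add: idle_state_def)
    then have "(\<Theta> + 2) * (\<bar>p - a\<bar> + opt - \<tau>) \<le> (2 * \<Theta> + 2) * opt"
      using \<open>0 \<le> \<tau>\<close> \<open>\<bar>a\<bar> \<le> \<tau>\<close> \<open>s1 \<le> \<tau>\<close> \<Theta> pu le_opt[OF N(1)] le_opt[OF u]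
      by (intro detour_bound[where u = u and t = s1]) auto
    moreover have "(\<Theta> + 2) * schedule_length s S \<le> (\<Theta> + 2) * (\<bar>p - a\<bar> + opt - \<tau>)"
      using l' \<Theta> by (intro mult_left_mono) auto
    ultimately have "(\<Theta> + 2) * schedule_length s S \<le> (2 * \<Theta> + 2) * opt" by linarith
    \<comment> \<open>Since \<open>s\<close> differs from \<open>t\<close>, it is a release time,
      hence at most the optimum's pickup time, or the length bound is tight.\<close>
    moreover have "s \<le> opt \<or> s = schedule_length s S / (\<Theta> - 1)"
    proof -
      have "finite U" using V(1) state(3) by (meson finite_Diff finite_lessThan finite_subset)
      then consider j where "j \<in> U" "s = rel_time (\<sigma> ! j)" | "s = L c \<sigma> s p (released \<sigma> U s) / (\<Theta> - 1)"
        using start_after_previous_round[OF _ assms(1) this_round(2,1)] this_round(3) False by metis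
      then show ?thesis
      proof cases
        case 1
        then have "Pickup j \<in> Pickup ` {..<length \<sigma>} \<union> Deliver ` {..<length \<sigma>}"
          using V(1) state(3) by blast
        then obtain v where v: "(v, Pickup j) \<in> set P" using schedule_event[OF P'] by blast
        then show ?thesis using release_le_event[OF P' v] le_opt[OF v] 1 by fastforce
      qed (use L_eq_length[OF this_round(4)] in simp)
    qed
    moreover have "0 \<le> opt" using le_opt[OF u] pu by linarith
    ultimately have "s + schedule_length s S \<le> f1 \<Theta> * opt"
      using \<Theta> by (intro waiting_bound) auto
    then show ?thesis using \<open>0 \<le> opt\<close> opt_def
      by (meson max.cobounded1 mult_right_mono order_trans)
  qed
qed

text \<open>Covers runs with a single round. The optimum starts at the same place, so the length is
  at most \<open>Opt\<close>, better than \<open>waiting_bound\<close> requires.\<close>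

lemma first_round_bound:
  assumes "c \<ge> 1" and \<Theta>: "2 \<le> \<Theta>" "\<Theta> \<le> 9/4"
    and inst: "dial_a_ride_instance \<sigma>" and "U = {..<length \<sigma>}"
    and start: "0 \<le> s" "may_start c \<Theta> \<sigma> 0 U s"
      "\<And>s'. 0 \<le> s' \<Longrightarrow> may_start c \<Theta> \<sigma> 0 U s' \<Longrightarrow> s \<le> s'"
    and S: "shortest_schedule c \<sigma> s 0 (released \<sigma> U s) S" and all: "released \<sigma> U s = U"
  shows "s + schedule_length s S \<le> f1 \<Theta> * Opt c \<sigma>"
proof -
  have U: "finite U" "U \<noteq> {}" using assms(5) inst by (auto simp: dial_a_ride_instance_def)
  obtain P where P: "shortest_schedule c \<sigma> 0 0 U P"
    using shortest_schedule_exists[OF U(1) assms(1)] .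
  then have P': "is_schedule c \<sigma> 0 0 U P" by (simp add: shortest_schedule_def)
  have opt: "Opt c \<sigma> = schedule_length 0 P" using L_eq_length[OF P] assms(5) by (simp add: Opt_def)
  have rel: "\<forall>i\<in>U. rel_time (\<sigma> ! i) \<le> s" using all by (auto simp: released_def)
  have "schedule_length s S \<le> Opt c \<sigma>"
    using L_mono_start[OF U assms(1) rel, of 0 0] L_eq_length[OF P] L_eq_length[OF S] opt all by simp
  have "0 \<le> Opt c \<sigma>" using end_position_le_length[OF P'] opt by simp
  have "s \<le> Opt c \<sigma> \<or> s = schedule_length s S / (\<Theta> - 1)"
  proof -
    consider "s = 0" | j where "j \<in> U" "s = rel_time (\<sigma> ! j)" | "s = L c \<sigma> s 0 (released \<sigma> U s) / (\<Theta> - 1)"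
      using start_after_previous_round[OF U(1) assms(1) start(2,1)] start(3) by metis
    then show ?thesis
    proof cases
      case 2
      obtain v where v: "(v, Pickup j) \<in> set P" using schedule_event[OF P', of "Pickup j"] 2 by blast
      then have "rel_time (\<sigma> ! j) \<le> v" using release_le_event[OF P' v] by blast
      moreover have "v \<le> fst (last P)"
        using executable_le_last[of \<sigma> 0 0 P v "Pickup j"] v P' by (simp add: is_schedule_iff)
      ultimately show ?thesis using v 2 opt by (auto simp: schedule_length_def)
    qed (use L_eq_length[OF S] \<open>0 \<le> Opt c \<sigma>\<close> in auto)
  qed
  moreover have "(\<Theta> + 2) * schedule_length s S \<le> (\<Theta> + 2) * Opt c \<sigma>"
    using \<open>schedule_length s S \<le> Opt c \<sigma>\<close> \<Theta> by simp
  then have "(\<Theta> + 2) * schedule_length s S \<le> (2 * \<Theta> + 2) * Opt c \<sigma>"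
    using mult_right_mono[of "\<Theta> + 2" "2 * \<Theta> + 2" "Opt c \<sigma>"] \<open>0 \<le> Opt c \<sigma>\<close> \<Theta> by linarith
  ultimately show ?thesis using \<Theta> \<open>0 \<le> Opt c \<sigma>\<close> by (intro waiting_bound) auto
qed

lemma smartstart_from_empty: "smartstart_from c \<Theta> \<sigma> t p {} T \<Longrightarrow> T = t"
  by (erule smartstart_from.cases) (auto simp: may_start_def released_def)

text \<open>Induction over the run, with the previous round generalised: the current round takes
  that role in the next step, and only the last one determines \<open>T\<close>.\<close>

lemma later_rounds_bound:
  assumes "smartstart_from c \<Theta> \<sigma> t p U T"
    and "c \<ge> 1" and \<Theta>: "2 \<le> \<Theta>" "\<Theta> \<le> 9/4"
    and "U \<noteq> {}"
    and prev: "idle_state \<Theta> \<sigma> \<beta> t0 q V" "t0 \<le> s1" "may_start c \<Theta> \<sigma> q V s1"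
      "shortest_schedule c \<sigma> s1 q (released \<sigma> V s1) S1"
    and state: "t = s1 + schedule_length s1 S1" "p = end_position \<sigma> q S1" "U = V - released \<sigma> V s1"
  shows "T \<le> max (f1 \<Theta>) (f2 \<Theta>) * Opt c \<sigma>"
  using assms(1) assms(5-)
proof (induction arbitrary: \<beta> t0 q V s1 S1 rule: smartstart_from.induct)
  case (round s t p U S T)
  obtain P where P: "shortest_schedule c \<sigma> 0 0 {..<length \<sigma>} P"
    using shortest_schedule_exists[OF _ assms(2)] by blast
  have *: "s + schedule_length s S \<le> max (f1 \<Theta>) (f2 \<Theta>) * Opt c \<sigma>"
    by (rule round_bound[OF assms(2) \<Theta> P round.prems(2-8) round.hyps(1-4)])
  show ?case
  proof (cases "U - released \<sigma> U s = {}")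
    case True
    then have "T = s + schedule_length s S" using round.hyps(5) smartstart_from_empty by metis
    then show ?thesis using * by simp
  next
    case False
    have "idle_state \<Theta> \<sigma> s1 t p U"
      using idle_state_round(2)[OF _ round.prems(2-5)] \<Theta> round.prems(6-8) by simp
    then show ?thesis
      using round.IH[OF False _ round.hyps(1,2,4)] by simp
  qed
qed simp

lemma smartstart_competitive:
  assumes "c \<ge> 1" "2 \<le> \<Theta>" "\<Theta> \<le> 9/4"
  shows "competitive c (max (f1 \<Theta>) (f2 \<Theta>)) (smartstart c \<Theta>)"
  unfolding competitive_def smartstart_def
proof (intro allI impI conjI)
  fix \<sigma> assume inst: "dial_a_ride_instance \<sigma>"
  define U where "U = {..<length \<sigma>}"
  show "\<exists>T. smartstart_from c \<Theta> \<sigma> 0 0 {..<length \<sigma>} T"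
    using smartstart_from_exists assms(1) by blast
  fix T assume "smartstart_from c \<Theta> \<sigma> 0 0 {..<length \<sigma>} T"
  then have "smartstart_from c \<Theta> \<sigma> 0 0 U T" by (simp add: U_def)
  then show "T \<le> max (f1 \<Theta>) (f2 \<Theta>) * Opt c \<sigma>"
  proof cases
    case finished
    then show ?thesis using inst by (auto simp: U_def dial_a_ride_instance_def lessThan_empty_iff)
  next
    case (round s S)
    show ?thesis
    proof (cases "U - released \<sigma> U s = {}")
      case True
      then have "released \<sigma> U s = U" by (auto simp: released_def)
      then have le: "s + schedule_length s S \<le> f1 \<Theta> * Opt c \<sigma>"
        using round by (intro first_round_bound[OF assms inst U_def]) auto
      have "0 \<le> Opt c \<sigma>"
      proof -
        obtain P where P: "shortest_schedule c \<sigma> 0 0 {..<length \<sigma>} P"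
          using shortest_schedule_exists[OF _ assms(1)] by blast
        then have "\<bar>end_position \<sigma> 0 P - 0\<bar> \<le> schedule_length 0 P"
          by (intro end_position_le_length[of c \<sigma> 0 0 "{..<length \<sigma>}"]) (simp add: shortest_schedule_def)
        then show ?thesis using L_eq_length[OF P] by (simp add: Opt_def)
      qed
      then have "f1 \<Theta> * Opt c \<sigma> \<le> max (f1 \<Theta>) (f2 \<Theta>) * Opt c \<sigma>"
        by (intro mult_right_mono) auto
      moreover have "T = s + schedule_length s S"
        using round(5) True smartstart_from_empty by metis
      ultimately show ?thesis using le by simp
    next
      case False
      have "idle_state \<Theta> \<sigma> 0 0 0 U"
        using inst by (auto simp: idle_state_def U_def dial_a_ride_instance_def)
      then show ?thesis
        using later_rounds_bound[OF round(5) assms False _ round(1,2,4)] by simp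
    qed
  qed
qed

section \<open>The optimal parameter\<close>

lemma f1_eq_f2_iff:
  assumes "x > 0"
  shows "f1 x = f2 x \<longleftrightarrow> 3 * x^4 + 2 * x^3 - 9 * x\<^sup>2 - 12 * x - 8 = 0"
proof (cases "x = 1")
  case True
  \<comment> \<open>Both sides are false: \<open>f1 1 = 0\<close> by division by zero,
    \<open>f2 1 = 2\<close>, and the polynomial is -24.\<close>
  then show ?thesis by (simp add: f1_def f2_def)
next
  case False
  have "x\<^sup>2 + x - 2 = (x - 1) * (x + 2)" by (simp add: algebra_simps power2_eq_square)
  then have nz: "x\<^sup>2 + x - 2 \<noteq> 0" "3 * x + 3 \<noteq> 0" using assms False by auto
  have f2: "f2 x = ((x + 1) * (3 * x + 3) - (x - 1)) / (3 * x + 3)"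
    using nz(2) by (simp add: f2_def diff_divide_distrib)
  have "f1 x = f2 x \<longleftrightarrow>
      (2 * x\<^sup>2 + 2 * x) * (3 * x + 3) = ((x + 1) * (3 * x + 3) - (x - 1)) * (x\<^sup>2 + x - 2)"
    unfolding f1_def f2 by (rule frac_eq_eq[OF nz])
  also have "\<dots> \<longleftrightarrow> 3 * x^4 + 2 * x^3 - 9 * x\<^sup>2 - 12 * x - 8 = 0"
    by (auto simp: algebra_simps power2_eq_square power3_eq_cube power4_eq_xxxx)
  finally show ?thesis .
qed

lemma f1_eq_f2_root:
  "\<exists>r. 2.052618 \<le> r \<and> r \<le> 2.052619 \<and> f1 r = f2 r \<and> (\<forall>x>0. f1 x = f2 x \<longrightarrow> x = r)"
proof -
  define g :: "real \<Rightarrow> real" where "g x = 3 * x^4 + 2 * x^3 - 9 * x\<^sup>2 - 12 * x - 8" for x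
  have "\<exists>r. 2.052618 \<le> r \<and> r \<le> 2.052619 \<and> g r = 0"
    by (rule IVT') (auto simp: g_def power2_eq_square power3_eq_cube power4_eq_xxxx intro!: continuous_intros)
  then obtain r where r: "2.052618 \<le> r" "r \<le> 2.052619" "g r = 0" by blast
  have uniq: "x = r" if x: "x > 0" "g x = 0" for x
  proof -
    \<comment> \<open>A Horner coefficient of the division of \<open>g\<close> by
      \<open>x - r\<close>. The cubic quotient is positive for \<open>x > 0\<close>, so
      \<open>r\<close> is the only positive root.\<close>
    define b where "b = - 9 + r * (2 + 3 * r)"
    have "2 * (2 + 3 * 2) \<le> r * (2 + 3 * r)" using r by (intro mult_mono) auto
    then have b: "7 \<le> b" by (simp add: b_def)
    then have "2 * 7 \<le> r * b" using r by (intro mult_mono) auto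
    have "0 = (x - r) * (3 * x^3 + (2 + 3 * r) * x\<^sup>2 + b * x + (r * b - 12))"
      using x(2) r(3) unfolding g_def b_def
      by (simp add: algebra_simps power2_eq_square power3_eq_cube power4_eq_xxxx)
    moreover have "0 < 3 * x^3 + (2 + 3 * r) * x\<^sup>2 + b * x + (r * b - 12)"
      using x(1) r b \<open>2 * 7 \<le> r * b\<close> by (intro add_nonneg_pos add_nonneg_nonneg) auto
    ultimately show ?thesis by simp
  qed
  show ?thesis
    using f1_eq_f2_iff uniq r unfolding g_def by (intro exI[of _ r]) auto
qed

theorem theorem3p8:
  fixes c :: enat
  assumes "c \<ge> 1"
  shows "(\<exists>!\<Theta>. \<Theta> > 0 \<and> f1 \<Theta> = f2 \<Theta>) \<and>
         Theta_star > 1 \<and>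
         rho_star = f2 Theta_star \<and>
         \<bar>rho_star - 2.93768\<bar> \<le> 0.000005 \<and>
         competitive c rho_star (smartstart c Theta_star)"
proof -
  obtain r where r: "2.052618 \<le> r" "r \<le> 2.052619" "f1 r = f2 r"
    and uniq: "\<forall>x>0. f1 x = f2 x \<longrightarrow> x = r"
    using f1_eq_f2_root by blast
  have star: "Theta_star = r"
    unfolding Theta_star_def by (rule the_equality) (use r uniq in auto)
  have rho: "rho_star = f2 r" by (simp add: rho_star_def star r)
  define y where "y = (r - 1) / (3 * r + 3)"
  have "y \<le> 0.114942" "0.11494 \<le> y"
    using r unfolding y_def by (simp_all add: field_simps)
  then have "\<bar>r + 1 - y - 2.93768\<bar> \<le> 0.000005" using r(1,2) by (simp add: abs_le_iff)
  then have "\<bar>f2 r - 2.93768\<bar> \<le> 0.000005" by (simp only: f2_def y_def)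
  \<comment> \<open>At \<open>r\<close> the two bounds coincide, so the maximum is
    \<open>rho_star\<close>.\<close>
  moreover have "competitive c (max (f1 r) (f2 r)) (smartstart c r)"
    using r by (intro smartstart_competitive assms) auto
  moreover have "\<exists>!\<Theta>. \<Theta> > 0 \<and> f1 \<Theta> = f2 \<Theta>"
    by (rule ex1I[of _ r]) (use r uniq in auto)
  ultimately show ?thesis using r star rho by simp
qed

end
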